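(* Let $n\ge 1$, $d\ge 2$, $B\ge 1$ and $\alpha\in(0,1)$. Assume the null hypothesis $H_0$ of joint independence holds, i.e. the data points $x_1,\dots,x_n\in\mathcal X=\mathcal X^1\times\cdots\times\mathcal X^d$ are sampled i.i.d. from a product distribution $\mathbb P_{X^1}\times\cdots\times\mathbb P_{X^d}$, and let $D=(x_1,\dots,x_n)$. Let $\psi_1=(\mathrm{id},\dots,\mathrm{id})$ and, independently of $D$, let $\psi_i=(\psi_i^1,\dots,\psi_i^{d-1})$, $i=2,\dots,B+1$, be i.i.d. vectors of $d-1$ permutations sampled i.i.d. uniformly from the symmetric group $S_n$. Let $R$ be the rank (largest entry has rank 1, ties broken at random) of the first entry of the vector $$\left(\widehat{\mathrm{dHSIC}}(\psi_1D),\dots,\widehat{\mathrm{dHSIC}}(\psi_{B+1}D)\right),$$ and let $\hat p=R/(B+1)$. Then the permutation test that rejects $H_0$ if and only if $\hat p\le\alpha$ rejects with probability at most $\alpha$, i.e. $\mathbb P(\hat p\le\alpha)\le\alpha$, where the probability is over the data $D$, the random permutations and the random tie-breaking.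
   Context: Setting. For $i=1,\dots,d$, $\mathcal X^i$ is a locally compact metric space with its Borel sigma-algebra; $\mathcal X=\mathcal X^1\times\cdots\times\mathcal X^d$ carries the product sigma-algebra. $X^i$ is an $\mathcal X^i$-valued random variable, all $X^i$ being defined on one probability space. Superscripts are indices, never powers. Each $k^i:\mathcal X^i\times\mathcal X^i\to\mathbb R$ is a $c_0$-universal kernel, meaning that it is continuous and its reproducing kernel Hilbert space is (contained and) dense, in the uniform norm, in $C_0(\mathcal X^i)$, the continuous functions vanishing at infinity. Estimator. With $M_q(n)=\{1,\dots,n\}^q$ and $D=(x_1,\dots,x_n)\in\mathcal X^n$, $x_i=(x_i^1,\dots,x_i^d)$, $$\widehat{\mathrm{dHSIC}}(D)=\frac{1}{n^2}\sum_{(i_1,i_2)\in M_2(n)}\prod_{j=1}^dk^j(x^j_{i_1},x^j_{i_2})+\frac{1}{n^{2d}}\sum_{(i_1,\dots,i_{2d})\in M_{2d}(n)}\prod_{j=1}^dk^j(x^j_{i_{2j-1}},x^j_{i_{2j}})-\frac{2}{n^{d+1}}\sum_{(i_1,\dots,i_{d+1})\in M_{d+1}(n)}\prod_{j=1}^dk^j(x^j_{i_1},x^j_{i_{j+1}}).$$ Permuted data. For a vector $\psi=(\psi^1,\dots,\psi^{d-1})$ of permutations of $\{1,\dots,n\}$, $\psi D$ is the dataset whose $i$-th point is $(x^1_i,x^2_{\psi^1(i)},\dots,x^d_{\psi^{d-1}(i)})$, $i=1,\dots,n$. Ranks with ties broken at random. If a vector has $k$ entries equal to a value $a$ and $l$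 entries strictly larger than $a$, then (given the vector) the rank of an entry with value $a$ is uniformly distributed on $\{l+1,\dots,l+k\}$.
   Formalization: The formal theorem additionally assumes that the estimator dHSIC is a measurable function of the dataset for the product sigma-algebra; this is automatic for separable factor spaces but can fail otherwise, and then the vector whose rank is taken need not be a random vector. *)

theory Defs
  imports "HOL-Probability.Probability" "HOL-Combinatorics.Permutations"
begin

text \<open>The factor spaces are metric spaces on carrier sets inside one ambient type, so that they may
  differ from index to index.\<close>

definition borel_of :: "'a topology \<Rightarrow> 'a measure" where
  "borel_of T = sigma (topspace T) {U. openin T U}"

definition C0 :: "'a topology \<Rightarrow> ('a \<Rightarrow> real) set" where
  "C0 T = {f \<in> extensional (topspace T). continuous_map T euclideanreal f \<and>
     (\<forall>e>0. compactin T {x \<in> topspace T. \<bar>f x\<bar> \<ge> e})}"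

text \<open>\<open>H\<close> with inner product \<open>ip\<close> is a Hilbert space of real functions on \<open>X\<close> with reproducing
  kernel \<open>k\<close>. Functions on \<open>X\<close> are represented as extensional functions.\<close>

definition is_RKHS ::
  "'a set \<Rightarrow> ('a \<Rightarrow> 'a \<Rightarrow> real) \<Rightarrow> ('a \<Rightarrow> real) set \<Rightarrow> (('a \<Rightarrow> real) \<Rightarrow> ('a \<Rightarrow> real) \<Rightarrow> real) \<Rightarrow> bool" where
  "is_RKHS X k H ip \<longleftrightarrow>
     H \<subseteq> extensional X \<and>
     (\<lambda>x\<in>X. 0) \<in> H \<and>
     (\<forall>f\<in>H. \<forall>g\<in>H. (\<lambda>x\<in>X. f x + g x) \<in> H) \<and>
     (\<forall>c. \<forall>f\<in>H. (\<lambda>x\<in>X. c * f x) \<in> H) \<and>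
     (\<forall>f\<in>H. \<forall>g\<in>H. ip f g = ip g f) \<and>
     (\<forall>f\<in>H. \<forall>g\<in>H. \<forall>h\<in>H. ip (\<lambda>x\<in>X. f x + g x) h = ip f h + ip g h) \<and>
     (\<forall>c. \<forall>f\<in>H. \<forall>g\<in>H. ip (\<lambda>x\<in>X. c * f x) g = c * ip f g) \<and>
     (\<forall>f\<in>H. ip f f \<ge> 0 \<and> (ip f f = 0 \<longrightarrow> f = (\<lambda>x\<in>X. 0))) \<and>
     (\<forall>s. (\<forall>m. s m \<in> H) \<and>
        (\<forall>e>0. \<exists>N. \<forall>m\<ge>N. \<forall>m'\<ge>N. 
           sqrt (ip (\<lambda>x\<in>X. s m x - s m' x) (\<lambda>x\<in>X. s m x - s m' x)) < e) \<longrightarrow>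
        (\<exists>f\<in>H. (\<lambda>m. sqrt (ip (\<lambda>x\<in>X. s m x - f x) (\<lambda>x\<in>X. s m x - f x))) \<longlonglongrightarrow> 0)) \<and>
     (\<forall>x\<in>X. (\<lambda>y\<in>X. k x y) \<in> H \<and> (\<forall>f\<in>H. ip f (\<lambda>y\<in>X. k x y) = f x))"

text \<open>Any \<open>k\<close> with an RKHS is symmetric and positive semidefinite, and by the Moore-Aronszajn theorem
  the RKHS of \<open>k\<close> is unique, so the existential quantifier below just names it.\<close>

definition c0_universal :: "'a topology \<Rightarrow> ('a \<Rightarrow> 'a \<Rightarrow> real) \<Rightarrow> bool" where
  "c0_universal T k \<longleftrightarrow>
     continuous_map (prod_topology T T) euclideanreal (\<lambda>(x, y). k x y) \<and>
     (\<exists>H ip. is_RKHS (topspace T) k H ip \<and> H \<subseteq> C0 T \<and>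
        (\<forall>f\<in>C0 T. \<forall>e>0. \<exists>h\<in>H. \<forall>x\<in>topspace T. \<bar>f x - h x\<bar> < e))"

definition tuples :: "nat \<Rightarrow> nat \<Rightarrow> (nat \<Rightarrow> nat) set" where
  "tuples q n = ({1..q} \<rightarrow>\<^sub>E {1..n})"

text \<open>For a dataset \<open>x\<close>, the \<open>j\<close>-th coordinate of the \<open>i\<close>-th point is \<open>x i j\<close>.\<close>

definition dHSIC ::
  "nat \<Rightarrow> nat \<Rightarrow> (nat \<Rightarrow> 'a \<Rightarrow> 'a \<Rightarrow> real) \<Rightarrow> (nat \<Rightarrow> nat \<Rightarrow> 'a) \<Rightarrow> real" where
  "dHSIC n d k x =
     1 / real n ^ 2 * (\<Sum>i\<in>tuples 2 n. \<Prod>j=1..d. k j (x (i 1) j) (x (i 2) j))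
   + 1 / real n ^ (2 * d) *
       (\<Sum>i\<in>tuples (2 * d) n. \<Prod>j=1..d. k j (x (i (2 * j - 1)) j) (x (i (2 * j)) j))
   - 2 / real n ^ (d + 1) *
       (\<Sum>i\<in>tuples (d + 1) n. \<Prod>j=1..d. k j (x (i 1) j) (x (i (j + 1)) j))"

definition permute_data ::
  "nat \<Rightarrow> nat \<Rightarrow> (nat \<Rightarrow> nat \<Rightarrow> nat) \<Rightarrow> (nat \<Rightarrow> nat \<Rightarrow> 'a) \<Rightarrow> nat \<Rightarrow> nat \<Rightarrow> 'a" where
  "permute_data n d \<psi> x =
     (\<lambda>i\<in>{1..n}. \<lambda>j\<in>{1..d}. if j = 1 then x i 1 else x (\<psi> (j - 1) i) j)"

definition dHSIC_vector ::
  "nat \<Rightarrow> nat \<Rightarrow> (nat \<Rightarrow> 'a \<Rightarrow> 'a \<Rightarrow> real) \<Rightarrow> nat \<Rightarrow> (nat \<Rightarrow> nat \<Rightarrow> nat \<Rightarrow> nat) \<Rightarrow>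
    (nat \<Rightarrow> nat \<Rightarrow> 'a) \<Rightarrow> nat \<Rightarrow> real" where
  "dHSIC_vector n d k B \<psi> x = (\<lambda>b\<in>{1..B+1}. dHSIC n d k (permute_data n d (\<psi> b) x))"

text \<open>The ranks \<open>l + 1, \<dots>, l + k\<close> available to an entry with value \<open>a\<close> of a vector with \<open>k\<close> entries
  equal to \<open>a\<close> and \<open>l\<close> entries larger than \<open>a\<close>.\<close>

definition tied_ranks :: "nat set \<Rightarrow> (nat \<Rightarrow> real) \<Rightarrow> real \<Rightarrow> nat set" where
  "tied_ranks I v a =
     {card {b\<in>I. v b > a} + 1 .. card {b\<in>I. v b > a} + card {b\<in>I. v b = a}}"

text \<open>Conditionally on the random vector \<open>V\<close>, the variable \<open>R\<close> is uniformly distributed on the ranks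
  available to the entry \<open>V b\<close>.\<close>

definition is_random_rank ::
  "'w measure \<Rightarrow> nat set \<Rightarrow> ('w \<Rightarrow> nat \<Rightarrow> real) \<Rightarrow> nat \<Rightarrow> ('w \<Rightarrow> nat) \<Rightarrow> bool" where
  "is_random_rank M I V b R \<longleftrightarrow>
     R \<in> measurable M (count_space UNIV) \<and>
     (\<forall>r. AE \<omega> in M.
        real_cond_exp M (vimage_algebra (space M) V (\<Pi>\<^sub>M i\<in>I. borel))
          (indicator {\<omega> \<in> space M. R \<omega> = r}) \<omega>
        = pmf (pmf_of_set (tied_ranks I (V \<omega>) (V \<omega> b))) r)"

abbreviation product_law :: "nat \<Rightarrow> (nat \<Rightarrow> 'a measure) \<Rightarrow> (nat \<Rightarrow> 'a) measure" where
  "product_law d P \<equiv> (\<Pi>\<^sub>M j\<in>{1..d}. P j)"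

abbreviation uniform_perms :: "nat \<Rightarrow> nat \<Rightarrow> (nat \<Rightarrow> nat \<Rightarrow> nat) measure" where
  "uniform_perms n d \<equiv> (\<Pi>\<^sub>M j\<in>{1..d-1}. uniform_count_measure {p. p permutes {1..n}})"

end

theory Submission
  imports Defs
begin

text \<open>Write \<open>V\<close> for the vector of statistics and \<open>h s c\<close> for the conditional probability that its \<open>c\<close>-th
  entry gets rank \<open>s\<close>. For every fixed vector, \<open>h s c\<close> sums to at most \<open>1\<close> over \<open>c\<close>, since only the
  entries of a single tied group compete for the rank \<open>s\<close>. So it suffices that \<open>h s c\<close> has the same
  expectation for all \<open>c\<close>: then \<open>R = s\<close> has probability at most \<open>1 / (B + 1)\<close> for each \<open>s \<ge> 1\<close>.
  For this, replace \<open>D\<close> by \<open>D' = \<psi>\<^sub>c D\<close>, which has the same law under the null hypothesis, and each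
  permutation vector \<open>\<psi>\<^sub>b\<close> by \<open>\<psi>\<^sub>c\<^sup>-\<^sup>1 \<psi>\<^sub>b\<close>, with the roles of \<open>1\<close> and \<open>c\<close> exchanged. The
  first vector is again the identity, the others are an involutive rearrangement of the uniform ones,
  and \<open>V\<close> only undergoes the transposition of \<open>1\<close> and \<open>c\<close>.\<close>

section \<open>Finite product measures and permutation of product data\<close>

text \<open>Both measures live on the power set of a finite set, so they are compared on singletons.
  A singleton of the product is a box, and its mass is the product of the
  \<open>1 / card (A i)\<close>.\<close>

lemma PiM_uniform_count_measure:
  assumes "finite I" and fin: "\<And>i. i \<in> I \<Longrightarrow> finite (A i)" and ne: "\<And>i. i \<in> I \<Longrightarrow> A i \<noteq> {}"
  shows "(\<Pi>\<^sub>M i\<in>I. uniform_count_measure (A i)) = uniform_count_measure (Pi\<^sub>E I A)"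
proof (rule measure_eqI_finite)
  show fin_PiE: "finite (Pi\<^sub>E I A)"
    using assms by (intro finite_PiE)
  \<comment> \<open>Outside \<open>I\<close> the sets are replaced by \<open>{}\<close>, because
    countability is required at every index; likewise \<open>?U\<close> below is a one-point space
    outside \<open>I\<close>, so as to be sigma-finite everywhere.\<close>
  let ?A = "\<lambda>i. if i \<in> I then A i else {}"
  have "sets (\<Pi>\<^sub>M i\<in>I. uniform_count_measure (A i)) = sets (\<Pi>\<^sub>M i\<in>I. count_space (?A i))"
    by (intro sets_PiM_cong) (auto simp: sets_uniform_count_measure)
  also have "\<dots> = Pow (Pi\<^sub>E I ?A)"
    using assms by (subst count_space_PiM_finite) (auto intro: countable_finite)
  also have "Pi\<^sub>E I ?A = Pi\<^sub>E I A"
    by (intro PiE_cong) auto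
  finally show "sets (\<Pi>\<^sub>M i\<in>I. uniform_count_measure (A i)) = Pow (Pi\<^sub>E I A)" .
  show "sets (uniform_count_measure (Pi\<^sub>E I A)) = Pow (Pi\<^sub>E I A)"
    by (simp add: sets_uniform_count_measure)
  fix a assume a: "a \<in> Pi\<^sub>E I A"
  let ?U = "\<lambda>i. if i \<in> I then uniform_count_measure (A i) else count_space {undefined}"
  interpret product_sigma_finite ?U
  proof (rule product_sigma_finite.intro)
    fix i show "sigma_finite_measure (?U i)"
      using prob_space_uniform_count_measure[OF fin ne]
      by (auto simp: prob_space_imp_sigma_finite intro: sigma_finite_measure_count_space_finite)
  qed
  have "(\<Pi>\<^sub>E i\<in>I. {a i}) = {a}"
    using a by (intro PiE_singleton) (auto simp: PiE_def)
  then have "emeasure (\<Pi>\<^sub>M i\<in>I. uniform_count_measure (A i)) {a} = emeasure (Pi\<^sub>M I ?U) (\<Pi>\<^sub>E i\<in>I. {a i})"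
    by (simp cong: PiM_cong)
  also have "\<dots> = (\<Prod>i\<in>I. emeasure (?U i) {a i})"
    using a by (intro emeasure_PiM) (auto simp: sets_uniform_count_measure assms)
  also have "\<dots> = (\<Prod>i\<in>I. ennreal (1 / card (A i)))"
  proof (intro prod.cong refl)
    fix i assume "i \<in> I"
    with a have "a i \<in> A i"
      by (rule PiE_mem)
    with \<open>i \<in> I\<close> show "emeasure (?U i) {a i} = ennreal (1 / card (A i))"
      using fin by (simp add: emeasure_uniform_count_measure)
  qed
  also have "\<dots> = ennreal (1 / card (Pi\<^sub>E I A))"
    using \<open>finite I\<close> by (simp add: prod_ennreal card_PiE prod_dividef)
  also have "\<dots> = emeasure (uniform_count_measure (Pi\<^sub>E I A)) {a}"
    using a fin_PiE by (simp add: emeasure_uniform_count_measure)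
  finally show "emeasure (\<Pi>\<^sub>M i\<in>I. uniform_count_measure (A i)) {a} =
      emeasure (uniform_count_measure (Pi\<^sub>E I A)) {a}" .
qed

text \<open>The coordinates of the flat product are independent. Grouping them into the disjoint
  rows \<open>{i} \<times> J\<close> keeps the rows independent, and each row has law
  \<open>Pi\<^sub>M J (M i)\<close>, so the joint law of the rows is the product of these
  laws.\<close>

lemma distr_PiM_curry:
  assumes "finite I" "I \<noteq> {}" and "finite J" "J \<noteq> {}"
    and prob: "\<And>i j. i \<in> I \<Longrightarrow> j \<in> J \<Longrightarrow> prob_space (M i j)"
  shows "distr (\<Pi>\<^sub>M p\<in>I \<times> J. M (fst p) (snd p)) (\<Pi>\<^sub>M i\<in>I. \<Pi>\<^sub>M j\<in>J. M i j) (\<lambda>z. \<lambda>i\<in>I. \<lambda>j\<in>J. z (i, j)) =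
    (\<Pi>\<^sub>M i\<in>I. \<Pi>\<^sub>M j\<in>J. M i j)"
proof -
  let ?M = "\<lambda>p. M (fst p) (snd p)"
  let ?N = "\<Pi>\<^sub>M p\<in>I \<times> J. ?M p"
  interpret N: prob_space ?N
    using prob by (intro prob_space_PiM) auto
  have "N.indep_vars ?M (\<lambda>p z. z p) (I \<times> J)"
  proof (subst N.indep_vars_iff_distr_eq_PiM')
    have "distr ?N ?N (\<lambda>z. \<lambda>p\<in>I \<times> J. z p) = distr ?N ?N (\<lambda>z. z)"
      by (intro distr_cong) (auto simp: space_PiM PiE_def extensional_restrict)
    also have "\<dots> = (\<Pi>\<^sub>M p\<in>I \<times> J. distr ?N (?M p) (\<lambda>z. z p))"
      using assms by (auto simp: distr_id intro!: PiM_cong distr_PiM_component[symmetric])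
    finally show "distr ?N ?N (\<lambda>z. \<lambda>p\<in>I \<times> J. z p) = (\<Pi>\<^sub>M p\<in>I \<times> J. distr ?N (?M p) (\<lambda>z. z p))" .
  qed (use assms in auto)
  then have "N.indep_vars (\<lambda>i. Pi\<^sub>M ({i} \<times> J) ?M) (\<lambda>i z. \<lambda>p\<in>{i} \<times> J. z p) I"
    by (rule N.indep_vars_restrict) (auto simp: disjoint_family_on_def)
  then have "N.indep_vars (\<lambda>i. Pi\<^sub>M J (M i)) (\<lambda>i z. \<lambda>j\<in>J. (\<lambda>p\<in>{i} \<times> J. z p) (i, j)) I"
  proof (rule N.indep_vars_compose2[where Y = "\<lambda>i w. \<lambda>j\<in>J. w (i, j)"], intro measurable_restrict)
    fix i j assume "i \<in> I" "j \<in> J"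
    then show "(\<lambda>w. w (i, j)) \<in> measurable (Pi\<^sub>M ({i} \<times> J) ?M) (M i j)"
      using measurable_component_singleton[of "(i, j)" "{i} \<times> J" ?M] by simp
  qed
  also have "(\<lambda>i z. \<lambda>j\<in>J. (\<lambda>p\<in>{i} \<times> J. z p) (i, j)) = (\<lambda>i z. \<lambda>j\<in>J. z (i, j))"
    by (auto simp: fun_eq_iff)
  finally have indep: "N.indep_vars (\<lambda>i. Pi\<^sub>M J (M i)) (\<lambda>i z. \<lambda>j\<in>J. z (i, j)) I" .
  have rv: "(\<lambda>z. \<lambda>j\<in>J. z (i, j)) \<in> measurable ?N (Pi\<^sub>M J (M i))" if "i \<in> I" for i
    using indep that by (auto simp: N.indep_vars_def)
  have "distr ?N (\<Pi>\<^sub>M i\<in>I. Pi\<^sub>M J (M i)) (\<lambda>z. \<lambda>i\<in>I. \<lambda>j\<in>J. z (i, j)) =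
      (\<Pi>\<^sub>M i\<in>I. distr ?N (Pi\<^sub>M J (M i)) (\<lambda>z. \<lambda>j\<in>J. z (i, j)))"
    using indep \<open>I \<noteq> {}\<close> rv by (simp add: N.indep_vars_iff_distr_eq_PiM')
  also have "\<dots> = (\<Pi>\<^sub>M i\<in>I. Pi\<^sub>M J (M i))"
  proof (intro PiM_cong refl)
    fix i assume "i \<in> I"
    then show "distr ?N (Pi\<^sub>M J (M i)) (\<lambda>z. \<lambda>j\<in>J. z (i, j)) = Pi\<^sub>M J (M i)"
      using distr_PiM_reindex[of "I \<times> J" ?M "\<lambda>j. (i, j)" J] prob by (auto simp: inj_on_def)
  qed
  finally show ?thesis .
qed

text \<open>Flattening the data into the single product over pairs \<open>(i, j)\<close> turns the permutation of the data
  into a reindexing of that product.\<close>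

lemma distr_permute_data:
  assumes "n \<ge> 1" "d \<ge> 1"
    and prob: "\<And>j. j \<in> {1..d} \<Longrightarrow> prob_space (P j)"
    and perm: "\<And>j. j \<in> {1..d-1} \<Longrightarrow> \<psi> j permutes {1..n}"
  defines "Q \<equiv> \<Pi>\<^sub>M i\<in>{1..n}. product_law d P"
  shows "permute_data n d \<psi> \<in> measurable Q Q" and "distr Q Q (permute_data n d \<psi>) = Q"
proof -
  \<comment> \<open>\<open>g (i, j)\<close> is the cell from which the permuted dataset takes its
    entry \<open>(i, j)\<close>. It keeps the column \<open>j\<close>, so the factor
    \<open>P j\<close> is unchanged by the reindexing, and it is injective because each
    \<open>\<psi> j\<close> is.\<close>
  define g where "g = (\<lambda>p. (if snd p = 1 then fst p else \<psi> (snd p - 1) (fst p), snd p))"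
  let ?K = "{1..n} \<times> {1..d}"
  let ?N = "\<Pi>\<^sub>M p\<in>?K. P (snd p)"
  let ?curry = "\<lambda>z. \<lambda>i\<in>{1..n}. \<lambda>j\<in>{1..d}. z (i, j)"
  have idx: "j - Suc 0 \<in> {1..d-1}" if "j \<in> {1..d}" "j \<noteq> 1" for j
    using that by auto
  have g: "g p \<in> ?K" if "p \<in> ?K" for p
    using that permutes_in_image[OF perm[OF idx]] by (cases p) (auto simp: g_def)
  have inj: "inj_on g ?K"
  proof (rule inj_onI)
    fix p q assume pq: "p \<in> ?K" "q \<in> ?K" "g p = g q"
    show "p = q"
    proof (cases "snd p = 1")
      case False
      then show ?thesis
        using pq permutes_inj[OF perm[OF idx], of "snd p"]
        by (cases p; cases q) (auto simp: g_def dest: injD)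
    qed (use pq in \<open>auto simp: g_def prod_eq_iff\<close>)
  qed
  have curry: "distr ?N Q ?curry = Q"
    using distr_PiM_curry[of "{1..n}" "{1..d}" "\<lambda>i. P"] assms by simp
  have curry_meas: "?curry \<in> measurable ?N Q"
    unfolding Q_def
  proof (intro measurable_restrict)
    fix i j assume "i \<in> {1..n}" "j \<in> {1..d}"
    then show "(\<lambda>z. z (i, j)) \<in> measurable ?N (P j)"
      using measurable_component_singleton[of "(i, j)" ?K "\<lambda>p. P (snd p)"] by simp
  qed
  have reindex: "distr ?N ?N (\<lambda>z. \<lambda>p\<in>?K. z (g p)) = ?N"
  proof -
    have "(\<Pi>\<^sub>M p\<in>?K. P (snd (g p))) = ?N"
      by (simp add: g_def)
    then show ?thesis
      using distr_PiM_reindex[of ?K "\<lambda>p. P (snd p)" g ?K] prob inj g by auto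
  qed
  have reindex_meas: "(\<lambda>z. \<lambda>p\<in>?K. z (g p)) \<in> measurable ?N ?N"
  proof (intro measurable_restrict)
    fix p assume "p \<in> ?K"
    then show "(\<lambda>z. z (g p)) \<in> measurable ?N (P (snd p))"
      using measurable_component_singleton[OF g, of p "\<lambda>p. P (snd p)"] by (simp add: g_def)
  qed
  show meas: "permute_data n d \<psi> \<in> measurable Q Q"
    unfolding Q_def permute_data_def
  proof (intro measurable_restrict)
    fix i j assume ij: "i \<in> {1..n}" "j \<in> {1..d}"
    have "fst (g (i, j)) \<in> {1..n}"
      using g[of "(i, j)"] ij by auto
    then have "(\<lambda>x. x (fst (g (i, j))) j) \<in> measurable (\<Pi>\<^sub>M i\<in>{1..n}. product_law d P) (P j)"
      using ij by (auto intro: measurable_compose[where g = "\<lambda>y. y j", OF measurable_component_singleton])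
    then show "(\<lambda>x. if j = 1 then x i 1 else x (\<psi> (j - 1) i) j)
        \<in> measurable (\<Pi>\<^sub>M i\<in>{1..n}. product_law d P) (P j)"
      by (cases "j = 1") (simp_all add: g_def)
  qed
  have "distr Q Q (permute_data n d \<psi>) = distr ?N Q (permute_data n d \<psi> \<circ> ?curry)"
    by (subst (1) curry[symmetric]) (rule distr_distr[OF meas curry_meas])
  also have "\<dots> = distr ?N Q (?curry \<circ> (\<lambda>z. \<lambda>p\<in>?K. z (g p)))"
  proof (intro distr_cong refl)
    fix z
    show "(permute_data n d \<psi> \<circ> ?curry) z = (?curry \<circ> (\<lambda>z. \<lambda>p\<in>?K. z (g p))) z"
      using permutes_in_image[OF perm[OF idx]]
      by (auto simp: permute_data_def g_def fun_eq_iff)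
  qed
  also have "\<dots> = distr (distr ?N ?N (\<lambda>z. \<lambda>p\<in>?K. z (g p))) Q ?curry"
    by (rule distr_distr[OF curry_meas reindex_meas, symmetric])
  also have "\<dots> = Q"
    by (simp only: reindex curry)
  finally show "distr Q Q (permute_data n d \<psi>) = Q" .
qed

section \<open>Conditional rank probabilities of a fixed vector\<close>

text \<open>The conditional law from \<open>is_random_rank\<close>, with the position
  \<open>c\<close> as last argument, since sums and permutations run over positions while
  \<open>s\<close> stays fixed.\<close>

definition rank_prob :: "nat set \<Rightarrow> nat \<Rightarrow> (nat \<Rightarrow> real) \<Rightarrow> nat \<Rightarrow> real" where
  "rank_prob I s v c = pmf (pmf_of_set (tied_ranks I v (v c))) s"

lemma rank_prob_nonneg: "0 \<le> rank_prob I s v c"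
  and rank_prob_le_1: "rank_prob I s v c \<le> 1"
  by (simp_all add: rank_prob_def pmf_le_1)

lemma rank_prob_eq:
  assumes "finite I" "c \<in> I"
  shows "rank_prob I s v c =
    (if s \<in> tied_ranks I v (v c) then 1 / card {b\<in>I. v b = v c} else 0)"
proof -
  \<comment> \<open>The entry at \<open>c\<close> belongs to its own tied group, so the set of
    available ranks is nonempty and \<open>pmf_of_set\<close> really is uniform on it.\<close>
  have "card {b\<in>I. v b = v c} > 0"
    using assms by (auto simp: card_gt_0_iff)
  then have "tied_ranks I v (v c) \<noteq> {}" "finite (tied_ranks I v (v c))"
    by (auto simp: tied_ranks_def)
  then show ?thesis
    by (simp add: rank_prob_def pmf_of_set indicator_def) (simp add: tied_ranks_def)
qed

lemma rank_prob_0: "finite I \<Longrightarrow> c \<in> I \<Longrightarrow> rank_prob I 0 v c = 0"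
  by (simp add: rank_prob_eq) (simp add: tied_ranks_def)

text \<open>For \<open>a < a'\<close> every entry with value at least \<open>a'\<close> is counted
  among the entries larger than \<open>a\<close>, so the ranks available to \<open>a'\<close> end
  before those available to \<open>a\<close> begin.\<close>

lemma disjoint_tied_ranks:
  assumes "finite I" "s \<in> tied_ranks I v a" "s \<in> tied_ranks I v a'"
  shows "a = a'"
proof -
  have "\<not> a < a'" if "s \<in> tied_ranks I v a" "s \<in> tied_ranks I v a'" for a a'
  proof
    assume "a < a'"
    have "card {b\<in>I. v b > a'} + card {b\<in>I. v b = a'} = card ({b\<in>I. v b > a'} \<union> {b\<in>I. v b = a'})"
      using \<open>finite I\<close> by (intro card_Un_disjoint[symmetric]) auto
    also have "\<dots> \<le> card {b\<in>I. v b > a}"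
      using \<open>finite I\<close> \<open>a < a'\<close> by (intro card_mono) auto
    finally show False
      using that by (auto simp: tied_ranks_def)
  qed
  then show ?thesis
    using assms by (meson linorder_neqE)
qed

text \<open>At most one tied group has \<open>s\<close> among its ranks, and each of its
  \<open>k\<close> members contributes \<open>1 / k\<close>. If there is no such group, all terms
  vanish.\<close>

lemma sum_rank_prob_le_1:
  assumes "finite I"
  shows "(\<Sum>c\<in>I. rank_prob I s v c) \<le> 1"
proof (cases "\<exists>c\<in>I. s \<in> tied_ranks I v (v c)")
  case True
  then obtain c where c: "c \<in> I" "s \<in> tied_ranks I v (v c)"
    by blast
  let ?C = "{b\<in>I. v b = v c}"
  have "(\<Sum>b\<in>I. rank_prob I s v b) = (\<Sum>b\<in>?C. rank_prob I s v b)"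
    using assms disjoint_tied_ranks[OF assms c(2)]
    by (intro sum.mono_neutral_right) (auto simp: rank_prob_eq split: if_splits)
  also have "\<dots> = (\<Sum>b\<in>?C. 1 / card ?C)"
    using assms c by (intro sum.cong) (auto simp: rank_prob_eq)
  also have "\<dots> \<le> 1"
    by simp
  finally show ?thesis .
next
  case False
  then show ?thesis
    using assms by (simp add: rank_prob_eq)
qed

text \<open>Ranks depend on a vector only through the numbers of entries above and equal to a given
  value, and relabelling the positions by \<open>\<tau>\<close> preserves these counts.\<close>

lemma rank_prob_permute:
  assumes "finite I" "\<tau> permutes I" "c \<in> I" and w: "\<And>b. b \<in> I \<Longrightarrow> w b = v (\<tau> b)"
  shows "rank_prob I s w c = rank_prob I s v (\<tau> c)"
proof -
  have card: "card {b\<in>I. A (w b)} = card {b\<in>I. A (v b)}" for A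
  proof -
    have "{b\<in>I. A (v b)} = \<tau> ` {b\<in>I. A (w b)}"
      using assms permutes_in_image[OF assms(2)] by (auto simp: image_iff) (metis permutes_def)
    then show ?thesis
      using permutes_inj[OF assms(2)] by (simp add: card_image inj_on_subset)
  qed
  show ?thesis
    by (simp only: rank_prob_def tied_ranks_def w[OF \<open>c \<in> I\<close>]
        card[of "\<lambda>a. v (\<tau> c) < a"] card[of "\<lambda>a. a = v (\<tau> c)"])
qed

text \<open>The vector enters only through two natural numbers, the counts of larger and of tied
  entries. Both are measurable and take countably many values.\<close>

lemma measurable_rank_prob:
  assumes "finite I" "c \<in> I"
  shows "(\<lambda>v. rank_prob I s v c) \<in> borel_measurable (\<Pi>\<^sub>M i\<in>I. borel)"
proof -
  have [measurable]: "(\<lambda>v. v b) \<in> borel_measurable (\<Pi>\<^sub>M i\<in>I. (borel :: real measure))" if "b \<in> I" for b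
    using that by (rule measurable_component_singleton)
  have "{v \<in> space (\<Pi>\<^sub>M i\<in>I. borel). b \<in> {b \<in> I. v c < v b}} \<in> sets (\<Pi>\<^sub>M i\<in>I. (borel :: real measure))"
    "{v \<in> space (\<Pi>\<^sub>M i\<in>I. borel). b \<in> {b \<in> I. v b = v c}} \<in> sets (\<Pi>\<^sub>M i\<in>I. (borel :: real measure))" for b
    using \<open>c \<in> I\<close> by (cases "b \<in> I"; simp)+
  from measurable_card[OF this(1)] measurable_card[OF this(2)]
  have l: "(\<lambda>v. card {b\<in>I. v c < v b}) \<in> measurable (\<Pi>\<^sub>M i\<in>I. (borel :: real measure)) (count_space UNIV)"
    and m: "(\<lambda>v. card {b\<in>I. v b = v c}) \<in> measurable (\<Pi>\<^sub>M i\<in>I. (borel :: real measure)) (count_space UNIV)" .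
  show ?thesis
    unfolding rank_prob_def tied_ranks_def
    by (rule measurable_compose_countable[OF measurable_compose[OF m] l]) simp
qed

section \<open>Permuted datasets and the change of base permutation\<close>

lemma permute_data_cong:
  assumes "\<And>j i. j \<in> {1..d-1} \<Longrightarrow> i \<in> {1..n} \<Longrightarrow> \<sigma> j i = \<tau> j i"
    and "\<And>j i. j \<in> {1..d-1} \<Longrightarrow> i \<in> {1..n} \<Longrightarrow> \<tau> j i \<in> {1..n}"
    and "\<And>i. i \<in> {1..n} \<Longrightarrow> x i = y i"
  shows "permute_data n d \<sigma> x = permute_data n d \<tau> y"
  unfolding permute_data_def
proof (intro restrict_ext)
  fix i j assume ij: "i \<in> {1..n}" "j \<in> {1..d}"
  show "(if j = 1 then x i 1 else x (\<sigma> (j - 1) i) j) = (if j = 1 then y i 1 else y (\<tau> (j - 1) i) j)"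
  proof (cases "j = 1")
    case False
    then have "j - 1 \<in> {1..d-1}"
      using ij by auto
    with False show ?thesis
      using assms ij by simp
  qed (use assms ij in simp)
qed

text \<open>Permutations act on the index by which a point is looked up, so the one applied later
  becomes the inner factor. This order is why rebasing multiplies by the inverse from the
  left.\<close>

lemma permute_data_permute_data:
  assumes "\<And>j i. j \<in> {1..d-1} \<Longrightarrow> i \<in> {1..n} \<Longrightarrow> \<tau> j i \<in> {1..n}"
  shows "permute_data n d \<tau> (permute_data n d \<sigma> x) = permute_data n d (\<lambda>j. \<sigma> j \<circ> \<tau> j) x"
  unfolding permute_data_def
proof (intro restrict_ext)
  fix i j assume ij: "i \<in> {1..n}" "j \<in> {1..d}"
  let ?x = "\<lambda>i\<in>{1..n}. \<lambda>j\<in>{1..d}. if j = 1 then x i 1 else x (\<sigma> (j - 1) i) j"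
  show "(if j = 1 then ?x i 1 else ?x (\<tau> (j - 1) i) j) =
      (if j = 1 then x i 1 else x ((\<sigma> (j - 1) \<circ> \<tau> (j - 1)) i) j)"
  proof (cases "j = 1")
    case False
    then have "j - 1 \<in> {1..d-1}"
      using ij by auto
    with False show ?thesis
      using assms[of "j - 1" i] ij by simp
  qed (use ij in simp)
qed

abbreviation perm_vectors :: "nat \<Rightarrow> nat \<Rightarrow> (nat \<Rightarrow> nat \<Rightarrow> nat) set" where
  "perm_vectors n d \<equiv> \<Pi>\<^sub>E j\<in>{1..d-1}. {p. p permutes {1..n}}"

text \<open>The random vectors are \<open>\<psi>\<^sub>2, \<dots>, \<psi>\<^sub>B\<^sub>+\<^sub>1\<close>; this prepends the deterministic \<open>\<psi>\<^sub>1\<close>.\<close>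

abbreviation with_id :: "nat \<Rightarrow> (nat \<Rightarrow> nat \<Rightarrow> nat \<Rightarrow> nat) \<Rightarrow> nat \<Rightarrow> nat \<Rightarrow> nat \<Rightarrow> nat" where
  "with_id d u \<equiv> u(1 := \<lambda>j\<in>{1..d-1}. id)"

text \<open>The entries of \<open>\<psi>\<^sub>c\<^sup>-\<^sup>1 \<psi>\<^sub>b\<close> after exchanging positions \<open>1\<close> and \<open>c\<close>; the case \<open>b = c\<close> comes from
  \<open>\<psi>\<^sub>1 = id\<close>.\<close>

definition rebase :: "nat \<Rightarrow> nat \<Rightarrow> nat \<Rightarrow> (nat \<Rightarrow> nat \<Rightarrow> nat \<Rightarrow> nat) \<Rightarrow> nat \<Rightarrow> nat \<Rightarrow> nat \<Rightarrow> nat" where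
  "rebase d B c u =
    (\<lambda>b\<in>{2..B+1}. \<lambda>j\<in>{1..d-1}. if b = c then inv (u c j) else inv (u c j) \<circ> u b j)"

lemma with_id_permutes:
  assumes "u \<in> {2..B+1} \<rightarrow>\<^sub>E perm_vectors n d" "b \<in> {1..B+1}" "j \<in> {1..d-1}"
  shows "with_id d u b j permutes {1..n}"
proof (cases "b = 1")
  case False
  then have "u b \<in> perm_vectors n d"
    using assms by (intro PiE_mem[OF assms(1)]) auto
  then have "u b j \<in> {p. p permutes {1..n}}"
    using assms by (rule_tac PiE_mem)
  with False show ?thesis
    by simp
qed (use assms in \<open>simp add: permutes_id\<close>)

lemma rebase_in:
  assumes u: "u \<in> {2..B+1} \<rightarrow>\<^sub>E perm_vectors n d" and c: "c \<in> {2..B+1}"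
  shows "rebase d B c u \<in> {2..B+1} \<rightarrow>\<^sub>E perm_vectors n d"
proof -
  have "u b j permutes {1..n}" if "b \<in> {2..B+1}" "j \<in> {1..d-1}" for b j
    using with_id_permutes[OF u, of b j] that by auto
  then show ?thesis
    using c unfolding rebase_def
    by (intro restrict_PiE_iff[THEN iffD2] ballI) (simp add: permutes_inv permutes_compose)
qed

text \<open>The \<open>c\<close>-th entry of the rebased vector is the inverse of the original one,
  so the second rebasing multiplies by \<open>u c j\<close> and cancels the first. Being its own
  inverse, the map is a bijection and preserves sums over all \<open>u\<close>.\<close>

lemma rebase_rebase:
  assumes u: "u \<in> {2..B+1} \<rightarrow>\<^sub>E perm_vectors n d" and c: "c \<in> {2..B+1}"
  shows "rebase d B c (rebase d B c u) = u"
proof (rule PiE_ext[OF rebase_in[OF rebase_in[OF u c] c] u])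
  fix b assume b: "b \<in> {2..B+1}"
  show "rebase d B c (rebase d B c u) b = u b"
  proof (rule PiE_ext[OF PiE_mem[OF rebase_in[OF rebase_in[OF u c] c] b] PiE_mem[OF u b]])
    fix j assume j: "j \<in> {1..d-1}"
    have "u c j permutes {1..n}"
      using with_id_permutes[OF u, of c j] c j by auto
    then have "inv (inv (u c j)) = u c j" "u c j \<circ> (inv (u c j) \<circ> u b j) = u b j"
      by (simp_all only: permutes_inv_inv permutes_inv_o o_assoc id_o)
    then show "rebase d B c (rebase d B c u) b j = u b j"
      using b c j by (simp add: rebase_def del: o_apply)
  qed
qed

lemma dHSIC_vector_rebase:
  assumes u: "u \<in> {2..B+1} \<rightarrow>\<^sub>E perm_vectors n d" and c: "c \<in> {2..B+1}" and b: "b \<in> {1..B+1}"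
  shows "dHSIC_vector n d k B (with_id d u) x b =
    dHSIC_vector n d k B (with_id d (rebase d B c u)) (permute_data n d (u c) x) (Transposition.transpose 1 c b)"
proof -
  let ?w = "with_id d (rebase d B c u)" and ?\<tau> = "Transposition.transpose 1 c"
  have \<tau>b: "?\<tau> b \<in> {1..B+1}"
    using b c permutes_in_image[OF permutes_swap_id[of 1 "{1..B+1}" c]] by auto
  have w: "u c j \<circ> ?w (?\<tau> b) j = with_id d u b j" if j: "j \<in> {1..d-1}" for j
  proof -
    have "u c j permutes {1..n}"
      using with_id_permutes[OF u, of c j] c j by auto
    then have inv: "u c j \<circ> inv (u c j) = id" "u c j \<circ> (inv (u c j) \<circ> u b j) = u b j"
      by (simp_all only: permutes_inv_o o_assoc id_o)
    \<comment> \<open>For \<open>b = 1\<close> the transposed position is \<open>c\<close>, and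
      \<open>u c j\<close> cancels against its inverse. For \<open>b = c\<close> it is
      \<open>1\<close>, where the identity leaves \<open>u c j\<close>. Every other position is
      fixed, and the factor \<open>inv (u c j)\<close> put there by \<open>rebase\<close>
      cancels.\<close>
    consider "b = 1" | "b = c" | "b \<noteq> 1" "b \<noteq> c"
      by blast
    then show ?thesis
      using b c j inv by cases (simp_all add: rebase_def transpose_apply_other del: o_apply)
  qed
  have "permute_data n d (?w (?\<tau> b)) (permute_data n d (u c) x) =
      permute_data n d (\<lambda>j. u c j \<circ> ?w (?\<tau> b) j) x"
  proof (rule permute_data_permute_data)
    fix j i assume "j \<in> {1..d-1}" "i \<in> {1..n}"
    then show "?w (?\<tau> b) j i \<in> {1..n}"
      using permutes_in_image[OF with_id_permutes[OF rebase_in[OF u c] \<tau>b]] by simp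
  qed
  also have "\<dots> = permute_data n d (with_id d u b) x"
  proof (rule permute_data_cong)
    fix j i assume j: "j \<in> {1..d-1}" and i: "i \<in> {1..n}"
    show "(u c j \<circ> ?w (?\<tau> b) j) i = with_id d u b j i"
      by (simp only: w[OF j])
    show "with_id d u b j i \<in> {1..n}"
      using i permutes_in_image[OF with_id_permutes[OF u b j]] by simp
  qed simp
  finally show ?thesis
    using b \<tau>b by (simp add: dHSIC_vector_def)
qed

section \<open>Measurability and exchangeability of the vector of statistics\<close>

lemma measurable_dHSIC_vector:
  assumes "n \<ge> 1" "d \<ge> 1" "\<And>j. j \<in> {1..d} \<Longrightarrow> prob_space (P j)"
    and dHSIC: "dHSIC n d k \<in> borel_measurable (\<Pi>\<^sub>M i\<in>{1..n}. product_law d P)"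
    and u: "u \<in> {2..B+1} \<rightarrow>\<^sub>E perm_vectors n d"
  shows "dHSIC_vector n d k B (with_id d u) \<in>
    measurable (\<Pi>\<^sub>M i\<in>{1..n}. product_law d P) (\<Pi>\<^sub>M b\<in>{1..B+1}. borel)"
  unfolding dHSIC_vector_def
  by (intro measurable_restrict measurable_compose[OF distr_permute_data(1) dHSIC]
      with_id_permutes[OF u] assms(1-3))

text \<open>Up to the factor \<open>1 / card U\<close>, both sides are expectations over independent
  data and uniform permutations. For a single \<open>u\<close>, invariance of \<open>Q\<close> under
  \<open>u c\<close> turns the integral for position \<open>c\<close> into the one for position
  \<open>1\<close> at the rebased \<open>u\<close>; summing over \<open>U\<close> then absorbs the
  rebasing.\<close>

lemma rank_prob_exchangeable:
  fixes P n d k B s defines "Q \<equiv> \<Pi>\<^sub>M i\<in>{1..n}. product_law d P"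
  assumes nd: "n \<ge> 1" "d \<ge> 1" "\<And>j. j \<in> {1..d} \<Longrightarrow> prob_space (P j)"
    and dHSIC: "dHSIC n d k \<in> borel_measurable Q"
    and c: "c \<in> {1..B+1}"
  defines "U \<equiv> {2..B+1} \<rightarrow>\<^sub>E perm_vectors n d"
    and "h \<equiv> \<lambda>u x. rank_prob {1..B+1} s (dHSIC_vector n d k B (with_id d u) x)"
  shows "(\<Sum>u\<in>U. \<integral>x. h u x c \<partial>Q) = (\<Sum>u\<in>U. \<integral>x. h u x 1 \<partial>Q)"
proof (cases "c = 1")
  case False
  with c have c': "c \<in> {2..B+1}"
    by auto
  have "(\<Sum>u\<in>U. \<integral>x. h u x c \<partial>Q) = (\<Sum>u\<in>U. \<integral>x. h (rebase d B c u) x 1 \<partial>Q)"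
  proof (intro sum.cong refl)
    fix u assume "u \<in> U"
    then have u: "u \<in> {2..B+1} \<rightarrow>\<^sub>E perm_vectors n d"
      by (simp add: U_def)
    have uc: "u c j permutes {1..n}" if "j \<in> {1..d-1}" for j
      using with_id_permutes[OF u c that] False by simp
    have "h u x c = h (rebase d B c u) (permute_data n d (u c) x) 1" for x
    proof -
      let ?v = "dHSIC_vector n d k B (with_id d (rebase d B c u)) (permute_data n d (u c) x)"
      have "Transposition.transpose 1 c permutes {1..B+1}"
        using c by (intro permutes_swap_id) auto
      then have "h u x c = rank_prob {1..B+1} s ?v (Transposition.transpose 1 c c)"
        unfolding h_def
        by (rule rank_prob_permute[OF finite_atLeastAtMost _ c]) (rule dHSIC_vector_rebase[OF u c'])
      then show ?thesis
        by (simp only: h_def transpose_apply_second)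
    qed
    then have "(\<integral>x. h u x c \<partial>Q) = (\<integral>x. h (rebase d B c u) (permute_data n d (u c) x) 1 \<partial>Q)"
      by simp
    also have "\<dots> = (\<integral>x. h (rebase d B c u) x 1 \<partial>distr Q Q (permute_data n d (u c)))"
    proof (rule integral_distr[symmetric])
      show "permute_data n d (u c) \<in> measurable Q Q"
        unfolding Q_def by (rule distr_permute_data(1)[OF nd uc])
      show "(\<lambda>x. h (rebase d B c u) x 1) \<in> borel_measurable Q"
        unfolding h_def Q_def
        by (rule measurable_compose[OF measurable_dHSIC_vector[OF nd dHSIC[unfolded Q_def]
              rebase_in[OF u c']] measurable_rank_prob]) auto
    qed
    also have "distr Q Q (permute_data n d (u c)) = Q"
      unfolding Q_def by (rule distr_permute_data(2)[OF nd uc])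
    finally show "(\<integral>x. h u x c \<partial>Q) = (\<integral>x. h (rebase d B c u) x 1 \<partial>Q)" .
  qed
  also have "\<dots> = (\<Sum>u\<in>U. \<integral>x. h u x 1 \<partial>Q)"
    unfolding U_def
    by (rule sum.reindex_bij_witness[where i = "rebase d B c" and j = "rebase d B c"])
      (simp_all only: rebase_in[OF _ c'] rebase_rebase[OF _ c'])
  finally show ?thesis .
qed simp

section \<open>Independence of the data and the permutations\<close>

text \<open>The library's \<open>indep_var\<close> forces both variables to have the same value type, so independence of
  differently typed variables is expressed through the sigma-algebras they generate.\<close>

lemma (in prob_space) indep_var_compose_vimage_algebra:
  assumes D: "random_variable N D" and E: "random_variable K E"
    and indep: "indep_set (sets (vimage_algebra (space M) D N)) (sets (vimage_algebra (space M) E K))"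
    and f: "f \<in> measurable N S" and g: "g \<in> measurable K T"
  shows "indep_var S (\<lambda>\<omega>. f (D \<omega>)) T (\<lambda>\<omega>. g (E \<omega>))"
proof -
  \<comment> \<open>Events described by \<open>h (Y \<omega>)\<close> lie in the sigma-algebra
    generated by \<open>Y\<close>, and independence passes to smaller families of events.\<close>
  have sub: "sigma_sets (space M) {(\<lambda>\<omega>. h (Y \<omega>)) -` A \<inter> space M | A. A \<in> sets L'} \<subseteq>
      sets (vimage_algebra (space M) Y L)"
    if Y: "random_variable L Y" and h: "h \<in> measurable L L'" for Y h and L :: "'x measure" and L' :: "'y measure"
  proof -
    have "(\<lambda>\<omega>. h (Y \<omega>)) \<in> measurable (vimage_algebra (space M) Y L) L'"
      using measurable_space[OF Y] by (intro measurable_compose[OF measurable_vimage_algebra1 h]) auto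
    from measurable_sets[OF this]
    have "{(\<lambda>\<omega>. h (Y \<omega>)) -` A \<inter> space M | A. A \<in> sets L'} \<subseteq> sets (vimage_algebra (space M) Y L)"
      by auto
    from sets.sigma_sets_subset[OF this] show ?thesis
      by simp
  qed
  show ?thesis
    unfolding indep_var_eq
  proof (intro conjI measurable_compose[OF D f] measurable_compose[OF E g])
    show "indep_set (sigma_sets (space M) {(\<lambda>\<omega>. f (D \<omega>)) -` A \<inter> space M | A. A \<in> sets S})
        (sigma_sets (space M) {(\<lambda>\<omega>. g (E \<omega>)) -` A \<inter> space M | A. A \<in> sets T})"
      using indep unfolding indep_set_def
      by (rule indep_sets_mono_sets) (use sub[OF D f] sub[OF E g] in \<open>auto split: bool.split\<close>)
  qed
qed

text \<open>A Fubini formula for a finitely valued variable: splitting along the events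
  \<open>\<Psi> = u\<close> leaves products of a function of \<open>D\<close> and an indicator of
  \<open>\<Psi>\<close>, which factor by independence, and each event has probability
  \<open>1 / card A\<close>.\<close>

lemma (in prob_space) expectation_indep_uniform:
  fixes \<phi> :: "'c \<Rightarrow> 'b \<Rightarrow> real"
  assumes fin: "finite A" and D: "random_variable N D" and \<Psi>: "random_variable (uniform_count_measure A) \<Psi>"
    and indep: "indep_set (sets (vimage_algebra (space M) D N))
      (sets (vimage_algebra (space M) \<Psi> (uniform_count_measure A)))"
    and distr: "distr M (uniform_count_measure A) \<Psi> = uniform_count_measure A"
    and meas: "\<And>u. u \<in> A \<Longrightarrow> \<phi> u \<in> borel_measurable N"
    and bound: "\<And>u x. u \<in> A \<Longrightarrow> x \<in> space N \<Longrightarrow> \<bar>\<phi> u x\<bar> \<le> C"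
  shows "expectation (\<lambda>\<omega>. \<phi> (\<Psi> \<omega>) (D \<omega>)) = (\<Sum>u\<in>A. \<integral>x. \<phi> u x \<partial>distr M N D) / card A"
proof -
  have \<Psi>_in: "\<Psi> \<omega> \<in> A" if "\<omega> \<in> space M" for \<omega>
    using measurable_space[OF \<Psi> that] by (simp add: space_uniform_count_measure)
  have ind_meas: "(indicator {u} :: _ \<Rightarrow> real) \<in> borel_measurable (uniform_count_measure A)" for u
    by (simp add: measurable_cong_sets[OF sets_uniform_count_measure_count_space refl])
  have \<phi>D: "integrable M (\<lambda>\<omega>. \<phi> u (D \<omega>))" if "u \<in> A" for u
    using measurable_compose[OF D meas[OF that]] bound[OF that measurable_space[OF D]]
    by (intro integrable_const_bound[where B = C]) auto
  have ind: "integrable M (\<lambda>\<omega>. indicator {u} (\<Psi> \<omega>) :: real)" for u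
    using measurable_compose[OF \<Psi> ind_meas]
    by (intro integrable_const_bound[where B = 1]) (auto simp: indicator_def)
  have indep_u: "indep_var borel (\<lambda>\<omega>. \<phi> u (D \<omega>)) borel (\<lambda>\<omega>. indicator {u} (\<Psi> \<omega>) :: real)" if "u \<in> A" for u
    by (rule indep_var_compose_vimage_algebra[OF D \<Psi> indep meas[OF that] ind_meas])
  have "expectation (\<lambda>\<omega>. \<phi> (\<Psi> \<omega>) (D \<omega>)) = expectation (\<lambda>\<omega>. \<Sum>u\<in>A. \<phi> u (D \<omega>) * indicator {u} (\<Psi> \<omega>))"
  proof (intro Bochner_Integration.integral_cong refl)
    fix \<omega> assume "\<omega> \<in> space M"
    have "(\<Sum>u\<in>A. \<phi> u (D \<omega>) * indicator {u} (\<Psi> \<omega>)) = (\<Sum>u\<in>A. if u = \<Psi> \<omega> then \<phi> u (D \<omega>) else 0)"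
      by (intro sum.cong) auto
    then show "\<phi> (\<Psi> \<omega>) (D \<omega>) = (\<Sum>u\<in>A. \<phi> u (D \<omega>) * indicator {u} (\<Psi> \<omega>))"
      using fin \<Psi>_in[OF \<open>\<omega> \<in> space M\<close>] by (simp add: sum.delta)
  qed
  also have "\<dots> = (\<Sum>u\<in>A. expectation (\<lambda>\<omega>. \<phi> u (D \<omega>) * indicator {u} (\<Psi> \<omega>)))"
    by (intro Bochner_Integration.integral_sum indep_var_integrable[OF indep_u] \<phi>D ind)
  also have "\<dots> = (\<Sum>u\<in>A. (\<integral>x. \<phi> u x \<partial>distr M N D) / card A)"
  proof (intro sum.cong refl)
    fix u assume u: "u \<in> A"
    have "expectation (\<lambda>\<omega>. indicator {u} (\<Psi> \<omega>) :: real) = (\<integral>v. indicator {u} v \<partial>uniform_count_measure A)"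
      using integral_distr[OF \<Psi> ind_meas[of u]] by (simp only: distr)
    also have "\<dots> = 1 / card A"
      using u fin by (simp add: measure_uniform_count_measure space_uniform_count_measure)
    finally show "expectation (\<lambda>\<omega>. \<phi> u (D \<omega>) * indicator {u} (\<Psi> \<omega>)) =
        (\<integral>x. \<phi> u x \<partial>distr M N D) / card A"
      using indep_var_lebesgue_integral[OF indep_u[OF u] \<phi>D[OF u] ind]
      by (simp add: integral_distr[OF D meas[OF u]])
  qed
  finally show ?thesis
    by (simp add: sum_divide_distrib)
qed

section \<open>The level of the permutation test\<close>

theorem theorem2:
  fixes n d B :: nat and \<alpha> :: real
    and X :: "nat \<Rightarrow> 'a set" and \<delta> :: "nat \<Rightarrow> 'a \<Rightarrow> 'a \<Rightarrow> real"
    and k :: "nat \<Rightarrow> 'a \<Rightarrow> 'a \<Rightarrow> real"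
    and P :: "nat \<Rightarrow> 'a measure"
    and M :: "'w measure"
    and x :: "nat \<Rightarrow> 'w \<Rightarrow> nat \<Rightarrow> 'a"
    and \<psi> :: "nat \<Rightarrow> 'w \<Rightarrow> nat \<Rightarrow> nat \<Rightarrow> nat"
    and R :: "'w \<Rightarrow> nat"
  assumes "n \<ge> 1" and "d \<ge> 2" and "B \<ge> 1" and "0 < \<alpha>" and "\<alpha> < 1"
    and metric: "\<And>j. j \<in> {1..d} \<Longrightarrow> Metric_space (X j) (\<delta> j)"
    and loc_compact: "\<And>j. j \<in> {1..d} \<Longrightarrow>
      locally_compact_space (Metric_space.mtopology (X j) (\<delta> j))"
    and kernel: "\<And>j. j \<in> {1..d} \<Longrightarrow> c0_universal (Metric_space.mtopology (X j) (\<delta> j)) (k j)"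
    \<comment> \<open>the estimator is a statistic; automatic if all factor spaces are separable, but not in general,
      since then the Borel sets of a product may exceed the product sigma-algebra\<close>
    and dHSIC_measurable: "dHSIC n d k \<in> borel_measurable
      (\<Pi>\<^sub>M i\<in>{1..n}. \<Pi>\<^sub>M j\<in>{1..d}. borel_of (Metric_space.mtopology (X j) (\<delta> j)))"
    and marginal_prob: "\<And>j. j \<in> {1..d} \<Longrightarrow> prob_space (P j)"
    and marginal_sets: "\<And>j. j \<in> {1..d} \<Longrightarrow>
      sets (P j) = sets (borel_of (Metric_space.mtopology (X j) (\<delta> j)))"
    and M: "prob_space M"
    and data_indep: "prob_space.indep_vars M (\<lambda>_. product_law d P) x {1..n}"
    and data_law: "\<And>i. i \<in> {1..n} \<Longrightarrow> distr M (product_law d P) (x i) = product_law d P"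
    and perm_id: "\<And>\<omega>. \<omega> \<in> space M \<Longrightarrow> \<psi> 1 \<omega> = (\<lambda>j\<in>{1..d-1}. id)"
    and perm_indep: "prob_space.indep_vars M (\<lambda>_. uniform_perms n d) \<psi> {2..B+1}"
    and perm_law: "\<And>b. b \<in> {2..B+1} \<Longrightarrow>
      distr M (uniform_perms n d) (\<psi> b) = uniform_perms n d"
    and data_perm_indep: "prob_space.indep_set M
      (sets (vimage_algebra (space M) (\<lambda>\<omega>. \<lambda>i\<in>{1..n}. x i \<omega>)
        (\<Pi>\<^sub>M i\<in>{1..n}. product_law d P)))
      (sets (vimage_algebra (space M) (\<lambda>\<omega>. \<lambda>b\<in>{2..B+1}. \<psi> b \<omega>)
        (\<Pi>\<^sub>M b\<in>{2..B+1}. uniform_perms n d)))"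
    and rank: "is_random_rank M {1..B+1}
      (\<lambda>\<omega>. dHSIC_vector n d k B (\<lambda>b. \<psi> b \<omega>) (\<lambda>i. x i \<omega>)) 1 R"
  shows "measure M {\<omega> \<in> space M. real (R \<omega>) / real (B + 1) \<le> \<alpha>} \<le> \<alpha>"
proof -
  interpret prob_space M by fact
  define Q where "Q = (\<Pi>\<^sub>M i\<in>{1..n}. product_law d P)"
  define U where "U = ({2..B+1} \<rightarrow>\<^sub>E perm_vectors n d)"
  define D where "D = (\<lambda>\<omega>. \<lambda>i\<in>{1..n}. x i \<omega>)"
  define \<Psi> where "\<Psi> = (\<lambda>\<omega>. \<lambda>b\<in>{2..B+1}. \<psi> b \<omega>)"
  define V where "V = (\<lambda>\<omega>. dHSIC_vector n d k B (\<lambda>b. \<psi> b \<omega>) (\<lambda>i. x i \<omega>))"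
  define F where "F = vimage_algebra (space M) V (\<Pi>\<^sub>M b\<in>{1..B+1}. borel)"
  have nd: "n \<ge> 1" "d \<ge> 1"
    using assms by auto
  have "finite {p. p permutes {1..n}}" and ne: "{p. p permutes {1..n}} \<noteq> {}"
    using permutes_id[of "{1..n}"] by (blast intro: finite_permutations)+
  then have fin: "finite (perm_vectors n d)" and "perm_vectors n d \<noteq> {}"
    and unif: "uniform_perms n d = uniform_count_measure (perm_vectors n d)"
    by (auto intro!: finite_PiE PiM_uniform_count_measure simp: PiE_eq_empty_iff)
  then have fin_U: "finite U" and U_ne: "U \<noteq> {}"
    and unif_U: "(\<Pi>\<^sub>M b\<in>{2..B+1}. uniform_perms n d) = uniform_count_measure U"
    by (auto intro!: finite_PiE PiM_uniform_count_measure simp: PiE_eq_empty_iff U_def simp del: PiE_restrict)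
  have dHSIC: "dHSIC n d k \<in> borel_measurable Q"
  proof -
    have "sets Q = sets (\<Pi>\<^sub>M i\<in>{1..n}. \<Pi>\<^sub>M j\<in>{1..d}. borel_of (Metric_space.mtopology (X j) (\<delta> j)))"
      unfolding Q_def using marginal_sets by (intro sets_PiM_cong) auto
    then show ?thesis
      using dHSIC_measurable by (simp cong: measurable_cong_sets)
  qed
  have x_rv: "random_variable (product_law d P) (x i)" if "i \<in> {1..n}" for i
    using data_indep that by (auto simp: indep_vars_def)
  have \<psi>_rv: "random_variable (uniform_perms n d) (\<psi> b)" if "b \<in> {2..B+1}" for b
    using perm_indep that by (auto simp: indep_vars_def)
  have D_rv: "random_variable Q D"
    unfolding Q_def D_def by (intro measurable_restrict x_rv)
  have \<Psi>_rv: "random_variable (uniform_count_measure U) \<Psi>"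
    unfolding unif_U[symmetric] \<Psi>_def by (intro measurable_restrict \<psi>_rv)
  have "distr M Q D = (\<Pi>\<^sub>M i\<in>{1..n}. distr M (product_law d P) (x i))"
    unfolding Q_def D_def using nd by (intro iffD1[OF indep_vars_iff_distr_eq_PiM' data_indep] x_rv) auto
  also have "\<dots> = Q"
    unfolding Q_def by (intro PiM_cong refl data_law)
  finally have distr_D: "distr M Q D = Q" .
  \<comment> \<open>\<open>B \<ge> 1\<close> makes \<open>{2..B+1}\<close> nonempty, as the
    description of independence by a product law requires; \<open>n \<ge> 1\<close> did the same for
    the data.\<close>
  have "distr M (uniform_count_measure U) \<Psi> = (\<Pi>\<^sub>M b\<in>{2..B+1}. distr M (uniform_perms n d) (\<psi> b))"
    unfolding unif_U[symmetric] \<Psi>_def using \<open>B \<ge> 1\<close>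
    by (intro iffD1[OF indep_vars_iff_distr_eq_PiM' perm_indep] \<psi>_rv) auto
  also have "\<dots> = uniform_count_measure U"
    unfolding unif_U[symmetric] by (intro PiM_cong refl perm_law)
  finally have distr_\<Psi>: "distr M (uniform_count_measure U) \<Psi> = uniform_count_measure U" .
  have indep: "indep_set (sets (vimage_algebra (space M) D Q))
      (sets (vimage_algebra (space M) \<Psi> (uniform_count_measure U)))"
    using data_perm_indep unfolding unif_U D_def Q_def \<Psi>_def .
  have \<Psi>_in: "\<Psi> \<omega> \<in> U" if "\<omega> \<in> space M" for \<omega>
    using measurable_space[OF \<Psi>_rv that] by (simp add: space_uniform_count_measure)
  \<comment> \<open>This exhibits \<open>V\<close> as a function of the independent pair
    \<open>\<Psi>\<close>, \<open>D\<close>; position \<open>1\<close> is the constant identity and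
    is put back by \<open>with_id\<close>.\<close>
  have V_eq: "V \<omega> = dHSIC_vector n d k B (with_id d (\<Psi> \<omega>)) (D \<omega>)" if \<omega>: "\<omega> \<in> space M" for \<omega>
    unfolding V_def dHSIC_vector_def
  proof (intro restrict_ext)
    fix b assume b: "b \<in> {1..B+1}"
    have "\<psi> b \<omega> = with_id d (\<Psi> \<omega>) b"
      using b perm_id[OF \<omega>] by (auto simp: \<Psi>_def)
    then have "permute_data n d (\<psi> b \<omega>) (\<lambda>i. x i \<omega>) = permute_data n d (with_id d (\<Psi> \<omega>) b) (D \<omega>)"
      using permutes_in_image[OF with_id_permutes[OF \<Psi>_in[OF \<omega>, unfolded U_def] b]]
      by (intro permute_data_cong) (simp_all add: D_def)
    then show "dHSIC n d k (permute_data n d (\<psi> b \<omega>) (\<lambda>i. x i \<omega>)) =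
        dHSIC n d k (permute_data n d (with_id d (\<Psi> \<omega>) b) (D \<omega>))"
      by simp
  qed
  have vec_meas: "dHSIC_vector n d k B (with_id d u) \<in> measurable Q (\<Pi>\<^sub>M b\<in>{1..B+1}. borel)"
    if "u \<in> U" for u
    using that dHSIC unfolding Q_def U_def by (intro measurable_dHSIC_vector nd marginal_prob)
  have V_rv: "random_variable (\<Pi>\<^sub>M b\<in>{1..B+1}. borel) V"
  proof -
    \<comment> \<open>\<open>\<Psi>\<close> takes finitely many values, and for each fixed value the
      vector is a measurable function of the data.\<close>
    have "random_variable (\<Pi>\<^sub>M b\<in>{1..B+1}. borel) (\<lambda>\<omega>. dHSIC_vector n d k B (with_id d (\<Psi> \<omega>)) (D \<omega>))"
    proof (rule measurable_compose_countable'[where I = U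
          and f = "\<lambda>u \<omega>. dHSIC_vector n d k B (with_id d u) (D \<omega>)"])
      show "\<Psi> \<in> measurable M (count_space U)"
        using \<Psi>_rv by (simp only: measurable_cong_sets[OF refl sets_uniform_count_measure_count_space])
      show "random_variable (\<Pi>\<^sub>M b\<in>{1..B+1}. borel) (\<lambda>\<omega>. dHSIC_vector n d k B (with_id d u) (D \<omega>))"
        if "u \<in> U" for u
        by (rule measurable_compose[OF D_rv vec_meas[OF that]])
    qed (rule countable_finite[OF fin_U])
    then show ?thesis
      by (simp only: V_eq cong: measurable_cong)
  qed
  have exchangeable: "expectation (\<lambda>\<omega>. rank_prob {1..B+1} s (V \<omega>) c) =
      expectation (\<lambda>\<omega>. rank_prob {1..B+1} s (V \<omega>) 1)" if c: "c \<in> {1..B+1}" for c s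
  proof -
    let ?h = "\<lambda>c u x. rank_prob {1..B+1} s (dHSIC_vector n d k B (with_id d u) x) c"
    have *: "expectation (\<lambda>\<omega>. rank_prob {1..B+1} s (V \<omega>) c) = (\<Sum>u\<in>U. \<integral>x. ?h c u x \<partial>Q) / card U"
      if "c \<in> {1..B+1}" for c
    proof -
      have "expectation (\<lambda>\<omega>. rank_prob {1..B+1} s (V \<omega>) c) = expectation (\<lambda>\<omega>. ?h c (\<Psi> \<omega>) (D \<omega>))"
        by (intro Bochner_Integration.integral_cong refl) (simp add: V_eq)
      also have "\<dots> = (\<Sum>u\<in>U. \<integral>x. ?h c u x \<partial>distr M Q D) / card U"
      proof (rule expectation_indep_uniform[OF fin_U D_rv \<Psi>_rv indep distr_\<Psi>])
        show "?h c u \<in> borel_measurable Q" if "u \<in> U" for u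
          by (rule measurable_compose[OF vec_meas[OF that] measurable_rank_prob]) (simp, fact)
        show "\<bar>?h c u x\<bar> \<le> 1" for u x
          by (simp only: abs_of_nonneg[OF rank_prob_nonneg] rank_prob_le_1)
      qed
      finally show ?thesis
        by (simp only: distr_D)
    qed
    show ?thesis
      using rank_prob_exchangeable[OF nd marginal_prob dHSIC[unfolded Q_def] c] *[OF c] *[of 1]
      by (simp add: Q_def U_def)
  qed
  have rank_int: "integrable M (\<lambda>\<omega>. rank_prob {1..B+1} s (V \<omega>) c)" if "c \<in> {1..B+1}" for c s
  proof (rule integrable_const_bound[where B = 1])
    show "(\<lambda>\<omega>. rank_prob {1..B+1} s (V \<omega>) c) \<in> borel_measurable M"
      by (rule measurable_compose[OF V_rv measurable_rank_prob[OF finite_atLeastAtMost that]])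
  qed (simp only: real_norm_def abs_of_nonneg[OF rank_prob_nonneg] rank_prob_le_1 eventually_True)
  have rank_le: "expectation (\<lambda>\<omega>. rank_prob {1..B+1} s (V \<omega>) 1) \<le> 1 / real (B + 1)" for s
  proof -
    \<comment> \<open>All \<open>B + 1\<close> positions have the same expectation, and their sum is
      the expectation of a variable that is pointwise at most \<open>1\<close>.\<close>
    have "real (B + 1) * expectation (\<lambda>\<omega>. rank_prob {1..B+1} s (V \<omega>) 1) =
        (\<Sum>c\<in>{1..B+1}. expectation (\<lambda>\<omega>. rank_prob {1..B+1} s (V \<omega>) c))"
      by (simp only: exchangeable sum_constant card_atLeastAtMost add_diff_cancel_right' Suc_eq_plus1 cong: sum.cong)
    also have "\<dots> = expectation (\<lambda>\<omega>. \<Sum>c\<in>{1..B+1}. rank_prob {1..B+1} s (V \<omega>) c)"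
      by (intro Bochner_Integration.integral_sum[symmetric] rank_int)
    also have "\<dots> \<le> expectation (\<lambda>\<omega>. 1)"
      by (intro integral_mono Bochner_Integration.integrable_sum rank_int sum_rank_prob_le_1
          finite_atLeastAtMost integrable_const)
    finally have "real (B + 1) * expectation (\<lambda>\<omega>. rank_prob {1..B+1} s (V \<omega>) 1) \<le> 1"
      by (simp only: prob_space lebesgue_integral_const scaleR_one)
    then show ?thesis
      by (intro iffD2[OF pos_le_divide_eq]) (simp, simp only: mult.commute)
  qed
  have R_rv: "R \<in> measurable M (count_space UNIV)"
    using rank by (simp add: is_random_rank_def)
  then have R_sets: "{\<omega> \<in> space M. R \<omega> = s} \<in> sets M" for s
    by measurable
  have "subalgebra M F"
    unfolding subalgebra_def F_def using V_rv
    by (auto simp: sets_vimage_algebra2 measurable_space dest: measurable_sets)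
  then interpret finite_measure_subalgebra M F
    by unfold_locales
  have prob_R: "prob {\<omega> \<in> space M. R \<omega> = s} = expectation (\<lambda>\<omega>. rank_prob {1..B+1} s (V \<omega>) 1)" for s
  proof -
    let ?R = "{\<omega> \<in> space M. R \<omega> = s}"
    have int: "integrable M (indicator ?R :: 'w \<Rightarrow> real)"
      using R_sets by (intro integrable_real_indicator) (auto simp: emeasure_eq_measure)
    have "prob ?R = expectation (indicator ?R)"
      using R_sets by simp
    \<comment> \<open>The conditional probability of \<open>R = s\<close> given \<open>V\<close> has
      mean \<open>prob ?R\<close>, and by \<open>is_random_rank\<close> it is almost surely
      \<open>rank_prob\<close> at position \<open>1\<close>.\<close>
    also have "\<dots> = expectation (real_cond_exp M F (indicator ?R))"
      using real_cond_exp_int(2)[OF int] by simp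
    also have "\<dots> = expectation (\<lambda>\<omega>. rank_prob {1..B+1} s (V \<omega>) 1)"
    proof (intro integral_cong_AE)
      show "AE \<omega> in M. real_cond_exp M F (indicator ?R) \<omega> = rank_prob {1..B+1} s (V \<omega>) 1"
        using rank by (simp add: is_random_rank_def rank_prob_def V_def F_def)
      show "(\<lambda>\<omega>. rank_prob {1..B+1} s (V \<omega>) 1) \<in> borel_measurable M"
        by (rule borel_measurable_integrable[OF rank_int]) simp
    qed simp
    finally show ?thesis .
  qed
  \<comment> \<open>The largest rank that leads to rejection: \<open>R \<omega>\<close> is a natural
    number, so it is at most \<open>\<alpha> * real (B + 1)\<close> exactly if it is at most the
    floor.\<close>
  define r where "r = nat \<lfloor>\<alpha> * real (B + 1)\<rfloor>"
  have "{\<omega> \<in> space M. real (R \<omega>) / real (B + 1) \<le> \<alpha>} = (\<Union>s\<in>{0..r}. {\<omega> \<in> space M. R \<omega> = s})"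
    using \<open>0 < \<alpha>\<close> by (auto simp: r_def divide_le_eq le_nat_floor) (simp add: le_nat_iff le_floor_iff)
  also have "prob \<dots> = (\<Sum>s\<in>{0..r}. prob {\<omega> \<in> space M. R \<omega> = s})"
    using R_sets by (intro finite_measure_finite_Union) (auto simp: disjoint_family_on_def)
  \<comment> \<open>Ranks start at \<open>1\<close>, so the value \<open>0\<close> has probability
    zero. Dropping it leaves \<open>r\<close> terms; with \<open>r + 1\<close> terms the bound would
    exceed \<open>\<alpha>\<close>.\<close>
  also have "\<dots> = (\<Sum>s\<in>{1..r}. prob {\<omega> \<in> space M. R \<omega> = s})"
    by (simp add: sum.atLeast_Suc_atMost prob_R rank_prob_0)
  also have "\<dots> \<le> (\<Sum>s\<in>{1..r}. 1 / real (B + 1))"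
    unfolding prob_R by (intro sum_mono rank_le)
  also have "\<dots> = real r / real (B + 1)"
    by simp
  also have "\<dots> \<le> \<alpha>"
  proof -
    have "real r \<le> \<alpha> * real (B + 1)"
      using \<open>0 < \<alpha>\<close> by (simp add: r_def)
    then show ?thesis
      by (simp add: divide_le_eq)
  qed
  finally show ?thesis .
qed

end
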